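(* Let $n\ge2$, let $c_{n-1}\in\mathbb{R}$, and let $c_k\ge0$ for $k\in\{0,\dots,n-2\}$ with $\sum_{k=0}^{n-2}c_k>0$. Then the level set of the general inverse $\sigma_k$ equation $$f(\lambda)=\lambda_1\cdots\lambda_n+c_{n-1}\sigma_{n-1}(\lambda)-\sum_{k=0}^{n-2}c_k\sigma_k(\lambda)=0,\qquad \lambda\in\mathbb{R}^n,$$ is convex.
   Context: $\sigma_k(\lambda)$ is the $k$-th elementary symmetric polynomial of $\lambda_1,\dots,\lambda_n$ ($\sigma_0=1$). "The level set $\{f=0\}$" means the connected component of $\{f=0\}$ that is contained in a translate $q+\Gamma_n$ of the positive orthant $\Gamma_n=\{\lambda_i>0\ \forall i\}$; it is the boundary of the unique connected component $\Gamma_f^n$ of $\{f>0\}$ contained in a translate of $\Gamma_n$. It is called convex if the closed region $\overline{\Gamma_f^n}$ it bounds is a convex set. *)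

theory Defs
  imports "HOL-Analysis.Analysis"
begin

definition esym :: "nat \<Rightarrow> real ^ 'n \<Rightarrow> real" where
  "esym k x = (\<Sum>I | I \<subseteq> (UNIV :: 'n set) \<and> card I = k. \<Prod>i\<in>I. x $ i)"

definition pos_orthant :: "(real ^ 'n) set" where
  "pos_orthant = {x. \<forall>i. 0 < x $ i}"

definition in_orthant_translate :: "(real ^ 'n) set \<Rightarrow> bool" where
  "in_orthant_translate S \<longleftrightarrow> (\<exists>q. S \<subseteq> (\<lambda>x. q + x) ` pos_orthant)"

definition is_level_set :: "(real ^ 'n \<Rightarrow> real) \<Rightarrow> (real ^ 'n) set \<Rightarrow> bool" where
  "is_level_set f S \<longleftrightarrow> S \<in> components {x. f x = 0} \<and> in_orthant_translate S"

definition is_positive_region :: "(real ^ 'n \<Rightarrow> real) \<Rightarrow> (real ^ 'n) set \<Rightarrow> bool" where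
  "is_positive_region f C \<longleftrightarrow> C \<in> components {x. f x > 0} \<and> in_orthant_translate C"

text \<open>
  ``The level set of f'' and the region it bounds are given by definite descriptions, so
  the first three conjuncts record that these descriptions denote and that the level set
  is the boundary of the region.  Without them, convexity of the closed region could hold
  vacuously or for an unrelated set.
\<close>
definition convex_level_set :: "(real ^ 'n \<Rightarrow> real) \<Rightarrow> bool" where
  "convex_level_set f \<longleftrightarrow>
     (\<exists>!S. is_level_set f S) \<and>
     (\<exists>!C. is_positive_region f C) \<and>
     (\<forall>S C. is_level_set f S \<and> is_positive_region f C \<longrightarrow>
        S = frontier C \<and> convex (closure C))"

definition inverse_sigma_poly :: "(nat \<Rightarrow> real) \<Rightarrow> real ^ 'n \<Rightarrow> real" where
  "inverse_sigma_poly c x =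
     (\<Prod>i\<in>UNIV. x $ i) + c (CARD('n) - 1) * esym (CARD('n) - 1) x
       - (\<Sum>k = 0..CARD('n) - 2. c k * esym k x)"

end

theory Submission
  imports Defs
begin

text \<open>
  Write \<open>e\<^sub>k\<close> for the elementary symmetric polynomials of the \<open>n\<close> coordinates and \<open>G\<close> for the
  Garding cone of \<open>e\<^sub>n\<^sub>-\<^sub>1\<close>, the open convex cone on which \<open>e\<^sub>n\<^sub>-\<^sub>1\<close> and all its
  iterated partial derivatives are positive. On \<open>G\<close> one may divide by \<open>e\<^sub>n\<^sub>-\<^sub>1\<close>:
  \<open>f > 0\<close> if and only if \<open>h > - c\<^sub>n\<^sub>-\<^sub>1\<close>, where
  \<open>h = e\<^sub>n / e\<^sub>n\<^sub>-\<^sub>1 - (\<Sum>k \<le> n - 2. c\<^sub>k e\<^sub>k / e\<^sub>n\<^sub>-\<^sub>1)\<close>.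
  The coefficient of arbitrary sign now enters as a constant only, and \<open>h\<close> is concave: the quotients
  \<open>e\<^sub>k\<^sub>+\<^sub>1 / e\<^sub>k\<close> are concave (\<open>concave_on_eratio\<close>), so
  \<open>e\<^sub>k / e\<^sub>n\<^sub>-\<^sub>1\<close>, a product of reciprocals of positive concave functions, is
  convex (\<open>convex_on_esub_quotient\<close>). Hence the region \<open>G \<inter> {f > 0}\<close> is convex.

  It remains to see that this set is the region that the level set bounds. As
  some \<open>c\<^sub>k\<close> with \<open>k \<le> n - 2\<close> is positive, the region stays away from the boundary of \<open>G\<close>:
  there \<open>e\<^sub>k / e\<^sub>n\<^sub>-\<^sub>1\<close> would tend to infinity, by Newton's inequalities
  (\<open>closure_region_subset_G\<close>). So the region is open and closed in \<open>{f > 0}\<close>, its frontier is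
  \<open>G \<inter> {f = 0}\<close>, and this is open and closed in \<open>{f = 0}\<close>.

  The two uniqueness statements use only that \<open>f\<close> is affine in each coordinate. A component of
  \<open>{f > 0}\<close> that is bounded below must be upward closed, because along a coordinate with negative
  slope it would escape to minus infinity; two upward closed sets meet
  (\<open>positive_region_unique\<close>). In a component of \<open>{f = 0}\<close> that is bounded below one can
  increase a coordinate at will while adjusting a single other one, since in a coordinate plane the
  zero set is the graph of a fractional linear function (\<open>level_set_slide\<close>). Doing so in all coordinates but one leads into \<open>G\<close>, hence into
  the frontier of the region (\<open>level_set_unique\<close>).
\<close>

section \<open>Elementary symmetric polynomials on a set of indices\<close>

text \<open>
  The index set is a parameter because the inductions below delete indices: the partial derivative of
  \<open>esub (Suc k) I\<close> with respect to the coordinate \<open>i\<close> is \<open>esub k (I - {i})\<close>.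
\<close>
definition esub :: "nat \<Rightarrow> 'n::finite set \<Rightarrow> real ^ 'n \<Rightarrow> real" where
  "esub k I x = (\<Sum>J | J \<subseteq> I \<and> card J = k. \<Prod>i\<in>J. x $ i)"

lemma esym_eq_esub: "esym k x = esub k UNIV x"
  by (simp add: esym_def esub_def)

lemma prod_eq_esub: "(\<Prod>i\<in>UNIV. x $ i) = esub CARD('n) (UNIV :: 'n::finite set) x"
proof -
  have "{J :: 'n set. card J = CARD('n)} = {UNIV}"
    using card_subset_eq[of "UNIV :: 'n set"] by auto
  then show ?thesis by (simp add: esub_def)
qed

lemma esub_0 [simp]: "esub 0 I x = 1"
proof -
  have "{J. J \<subseteq> I \<and> card J = 0} = {{}}" by auto
  then show ?thesis by (simp add: esub_def)
qed

lemma esub_eq_0: "card I < k \<Longrightarrow> esub k I x = 0"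
proof -
  assume k: "card I < k"
  have "\<not> (J \<subseteq> I \<and> card J = k)" for J
    using card_mono[of I J] k by auto
  then have "{J. J \<subseteq> I \<and> card J = k} = {}" by blast
  then show ?thesis by (simp only: esub_def sum.empty)
qed

lemma sum_subsets_containing:
  assumes "i \<in> I"
  shows "(\<Sum>K | K \<subseteq> I \<and> card K = Suc k \<and> i \<in> K. \<Prod>j\<in>K. x $ j) = x $ i * esub k (I - {i}) x"
proof -
  have "(\<Sum>K | K \<subseteq> I \<and> card K = Suc k \<and> i \<in> K. \<Prod>j\<in>K. x $ j)
      = (\<Sum>J | J \<subseteq> I - {i} \<and> card J = k. x $ i * (\<Prod>j\<in>J. x $ j))"
  proof (rule sum.reindex_bij_witness[where i = "insert i" and j = "\<lambda>K. K - {i}"])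
    fix J assume "J \<in> {J. J \<subseteq> I - {i} \<and> card J = k}"
    then have J: "J \<subseteq> I - {i}" "card J = k" "i \<notin> J" by auto
    show "insert i J - {i} = J" using J by auto
    show "insert i J \<in> {K. K \<subseteq> I \<and> card K = Suc k \<and> i \<in> K}" using J assms by auto
  next
    fix K assume "K \<in> {K. K \<subseteq> I \<and> card K = Suc k \<and> i \<in> K}"
    then have K: "K \<subseteq> I" "card K = Suc k" "i \<in> K" by auto
    show "insert i (K - {i}) = K" using K by auto
    show "K - {i} \<in> {J. J \<subseteq> I - {i} \<and> card J = k}" using K by auto
    show "x $ i * (\<Prod>j\<in>K - {i}. x $ j) = (\<Prod>j\<in>K. x $ j)"
      using K(3) by (metis finite prod.remove)
  qed
  then show ?thesis by (simp add: esub_def sum_distrib_left)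
qed

lemma esub_Suc_remove:
  assumes "i \<in> I"
  shows "esub (Suc k) I x = x $ i * esub k (I - {i}) x + esub (Suc k) (I - {i}) x"
proof -
  have "{K. K \<subseteq> I \<and> card K = Suc k} =
      {K. K \<subseteq> I \<and> card K = Suc k \<and> i \<in> K} \<union> {K. K \<subseteq> I - {i} \<and> card K = Suc k}"
    by auto
  then have "esub (Suc k) I x = (\<Sum>K | K \<subseteq> I \<and> card K = Suc k \<and> i \<in> K. \<Prod>j\<in>K. x $ j)
      + esub (Suc k) (I - {i}) x"
    by (simp only: esub_def) (subst sum.union_disjoint, auto)
  then show ?thesis using sum_subsets_containing[OF assms] by simp
qed

text \<open>
  Euler's identity for the homogeneous polynomial \<open>esub (Suc k) I\<close>: a set of \<open>Suc k\<close> indices arises once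
  for each choice of its distinguished element \<open>i\<close>.
\<close>
lemma sum_coord_esub_remove:
  "(\<Sum>i\<in>I. x $ i * esub k (I - {i}) x) = real (Suc k) * esub (Suc k) I x"
proof -
  have "(\<Sum>i\<in>I. x $ i * esub k (I - {i}) x)
      = (\<Sum>i\<in>I. \<Sum>K\<in>{K. K \<subseteq> I \<and> card K = Suc k}. if i \<in> K then \<Prod>j\<in>K. x $ j else 0)"
  proof (rule sum.cong[OF refl])
    fix i assume "i \<in> I"
    have "{K \<in> {K. K \<subseteq> I \<and> card K = Suc k}. i \<in> K} = {K. K \<subseteq> I \<and> card K = Suc k \<and> i \<in> K}"
      by auto
    then show "x $ i * esub k (I - {i}) x =
        (\<Sum>K\<in>{K. K \<subseteq> I \<and> card K = Suc k}. if i \<in> K then \<Prod>j\<in>K. x $ j else 0)"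
      using sum_subsets_containing[OF \<open>i \<in> I\<close>] by (simp add: sum.inter_filter[symmetric])
  qed
  also have "\<dots> = (\<Sum>K\<in>{K. K \<subseteq> I \<and> card K = Suc k}. \<Sum>i\<in>I. if i \<in> K then \<Prod>j\<in>K. x $ j else 0)"
    by (rule sum.swap)
  also have "\<dots> = (\<Sum>K\<in>{K. K \<subseteq> I \<and> card K = Suc k}. real (Suc k) * (\<Prod>j\<in>K. x $ j))"
  proof (rule sum.cong[OF refl])
    fix K assume "K \<in> {K. K \<subseteq> I \<and> card K = Suc k}"
    then have "{i \<in> I. i \<in> K} = K" "card K = Suc k" by auto
    then show "(\<Sum>i\<in>I. if i \<in> K then \<Prod>j\<in>K. x $ j else 0) = real (Suc k) * (\<Prod>j\<in>K. x $ j)"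
      by (simp add: sum.inter_filter[symmetric])
  qed
  finally show ?thesis by (simp add: esub_def sum_distrib_left)
qed

lemma esub_1: "esub (Suc 0) I x = (\<Sum>i\<in>I. x $ i)"
  using sum_coord_esub_remove[where k = 0 and I = I and x = x] by simp

lemma sum_esub_remove:
  assumes "k \<le> card I"
  shows "(\<Sum>i\<in>I. esub k (I - {i}) x) = real (card I - k) * esub k I x"
proof (cases k)
  case (Suc m)
  have "(\<Sum>i\<in>I. esub (Suc m) (I - {i}) x)
      = (\<Sum>i\<in>I. esub (Suc m) I x - x $ i * esub m (I - {i}) x)"
    by (intro sum.cong refl) (simp add: esub_Suc_remove)
  also have "\<dots> = (real (card I) - real (Suc m)) * esub (Suc m) I x"
    by (simp add: sum_subtractf sum_coord_esub_remove algebra_simps)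
  finally show ?thesis using Suc assms by (simp add: of_nat_diff)
qed simp

lemma continuous_on_esub [continuous_intros]: "continuous_on S (esub k I)"
  unfolding esub_def[abs_def] by (intro continuous_intros)

lemma esub_scaleR: "esub k I (t *\<^sub>R x) = t ^ k * esub k I x"
  by (simp add: esub_def sum_distrib_left prod.distrib)

text \<open>
  The Garding cone of \<open>esub k I\<close>. The recursion asks that all iterated partial derivatives of
  \<open>esub k I\<close> be positive, so that deletion of an index maps cones to cones.
\<close>
fun gcone :: "nat \<Rightarrow> 'n::finite set \<Rightarrow> (real ^ 'n) set" where
  "gcone 0 I = UNIV"
| "gcone (Suc k) I = {x. 0 < esub (Suc k) I x \<and> (\<forall>i\<in>I. x \<in> gcone k (I - {i}))}"

lemma gcone_esub_pos: "x \<in> gcone k I \<Longrightarrow> 0 < esub k I x"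
  by (cases k) auto

lemma gcone_remove: "\<lbrakk>x \<in> gcone (Suc k) I; i \<in> I\<rbrakk> \<Longrightarrow> x \<in> gcone k (I - {i})"
  by simp

lemma gcone_card: "x \<in> gcone k I \<Longrightarrow> k \<le> card I"
  by (metis esub_eq_0 gcone_esub_pos less_irrefl not_le_imp_less)

lemma open_gcone: "open (gcone k I)"
proof (induction k arbitrary: I)
  case (Suc k)
  have "gcone (Suc k) I = {x. 0 < esub (Suc k) I x} \<inter> (\<Inter>i\<in>I. gcone k (I - {i}))" by auto
  moreover have "open {x. 0 < esub (Suc k) I x}"
    by (intro open_Collect_less continuous_intros)
  moreover have "open (\<Inter>i\<in>I. gcone k (I - {i}))" using Suc by (intro open_INT) auto
  ultimately show ?case by (simp only: open_Int)
qed simp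

text \<open>
  The sum over \<open>i\<close> of the polynomials \<open>esub k (I - {i})\<close>, which are positive on the smaller cone, is a
  positive multiple of \<open>esub k I\<close>.
\<close>
lemma gcone_Suc_subset: "gcone (Suc k) I \<subseteq> gcone k I"
proof (induction k arbitrary: I)
  case (Suc k)
  show ?case
  proof
    fix x assume x: "x \<in> gcone (Suc (Suc k)) I"
    have c: "Suc (Suc k) \<le> card I" by (rule gcone_card[OF x])
    then have "I \<noteq> {}" by auto
    moreover have "\<And>i. i \<in> I \<Longrightarrow> 0 < esub (Suc k) (I - {i}) x"
      using x gcone_remove gcone_esub_pos by blast
    ultimately have "0 < (\<Sum>i\<in>I. esub (Suc k) (I - {i}) x)"
      by (intro sum_pos) auto
    also have "\<dots> = real (card I - Suc k) * esub (Suc k) I x"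
      using c by (intro sum_esub_remove) simp
    finally have "0 < esub (Suc k) I x" using c by (simp add: zero_less_mult_iff)
    moreover have "x \<in> gcone k (I - {i})" if "i \<in> I" for i
      using Suc.IH gcone_remove[OF x that] by blast
    ultimately show "x \<in> gcone (Suc k) I" by simp
  qed
qed simp

lemma gcone_antimono: "m \<le> k \<Longrightarrow> gcone k I \<subseteq> gcone m I"
  by (induction k rule: dec_induct) (use gcone_Suc_subset in blast)+

lemma esub_pos:
  assumes "\<And>i. i \<in> I \<Longrightarrow> 0 < x $ i" "k \<le> card I"
  shows "0 < esub k I x"
proof -
  have "\<exists>J. J \<subseteq> I \<and> card J = k" using assms(2) by (metis obtain_subset_with_card_n)
  moreover have "0 < (\<Prod>i\<in>J. x $ i)" if "J \<subseteq> I" for J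
    using that assms(1) by (intro prod_pos) auto
  ultimately show ?thesis unfolding esub_def by (intro sum_pos) auto
qed

text \<open>
  With \<open>A = I - {j}\<close>, Euler's identity bounds the part without \<open>x\<^sub>j\<close> from below:
  \<open>esub (Suc m) A x\<close> is at least \<open>M / n\<close> times \<open>esub m A x\<close>. This outweighs the possibly negative term
  \<open>x\<^sub>j * esub m A x\<close>.
\<close>
lemma esub_pos_if_one_dominated:
  fixes I :: "'n::finite set"
  assumes big: "\<And>i. \<lbrakk>i \<in> I; i \<noteq> j\<rbrakk> \<Longrightarrow> M \<le> x $ i"
    and M: "0 < M" "0 < x $ j + M / real CARD('n)" and k: "k < card I"
  shows "0 < esub k I x"
proof (cases "j \<in> I \<and> k \<noteq> 0")
  case True
  then obtain m where j: "j \<in> I" and m: "k = Suc m" by (cases k) auto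
  let ?A = "I - {j}"
  have bigA: "M \<le> x $ i" "0 < x $ i" if "i \<in> ?A" for i
    using big[of i] M(1) that by auto
  have card: "Suc m \<le> card ?A" using j k m by simp
  have p: "0 < esub m ?A x" using card bigA by (intro esub_pos) auto
  have "1 \<le> real (card ?A - m)" using card by linarith
  then have "M * esub m ?A x \<le> M * (real (card ?A - m) * esub m ?A x)"
    using p M(1) by simp
  also have "\<dots> = (\<Sum>i\<in>?A. M * esub m (?A - {i}) x)"
    using card by (simp only: sum_esub_remove[OF Suc_leD] flip: sum_distrib_left)
  also have "\<dots> \<le> (\<Sum>i\<in>?A. x $ i * esub m (?A - {i}) x)"
  proof (intro sum_mono mult_right_mono)
    fix i assume i: "i \<in> ?A"
    then show "M \<le> x $ i" by (rule bigA)
    have "m \<le> card (?A - {i})" using i card by (subst card_Diff_singleton) auto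
    then show "0 \<le> esub m (?A - {i}) x" using bigA by (intro less_imp_le[OF esub_pos]) auto
  qed
  also have "\<dots> = real (Suc m) * esub (Suc m) ?A x" by (rule sum_coord_esub_remove)
  also have "\<dots> \<le> real CARD('n) * esub (Suc m) ?A x"
  proof (intro mult_right_mono)
    have "card ?A \<le> CARD('n)" by (rule card_mono) auto
    then show "real (Suc m) \<le> real CARD('n)" using card by linarith
    show "0 \<le> esub (Suc m) ?A x" using card bigA by (intro less_imp_le[OF esub_pos]) auto
  qed
  finally have "M / real CARD('n) * esub m ?A x \<le> esub (Suc m) ?A x"
    by (simp add: field_simps)
  moreover have "0 < (x $ j + M / real CARD('n)) * esub m ?A x" using p M(2) by simp
  ultimately show ?thesis using m by (simp add: esub_Suc_remove[OF j] algebra_simps)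
next
  case trivial: False
  show ?thesis
  proof (cases "k = 0")
    case False
    then have "j \<notin> I" using trivial by simp
    then have "0 < x $ i" if "i \<in> I" for i using big[OF that] M(1) that by force
    then show ?thesis using k by (intro esub_pos) auto
  qed simp
qed

lemma gcone_if_one_dominated:
  fixes I :: "'n::finite set"
  assumes "\<And>i. \<lbrakk>i \<in> I; i \<noteq> j\<rbrakk> \<Longrightarrow> M \<le> x $ i"
    and "0 < M" "0 < x $ j + M / real CARD('n)" and "k < card I"
  shows "x \<in> gcone k I"
  using assms(1,4)
proof (induction k arbitrary: I)
  case (Suc k)
  have "0 < esub (Suc k) I x"
    using Suc.prems assms(2,3) by (intro esub_pos_if_one_dominated[where j = j and M = M]) auto
  moreover have "x \<in> gcone k (I - {i})" if "i \<in> I" for i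
  proof (rule Suc.IH)
    show "k < card (I - {i})" using Suc.prems(2) that by (subst card_Diff_singleton) auto
  qed (use Suc.prems(1) in auto)
  ultimately show ?case by simp
qed simp

section \<open>Concavity of quotients of consecutive polynomials\<close>

definition eratio :: "nat \<Rightarrow> 'n::finite set \<Rightarrow> real ^ 'n \<Rightarrow> real" where
  "eratio k I x = esub (Suc k) I x / esub k I x"

lemma esub_Suc_eq_eratio: "x \<in> gcone k I \<Longrightarrow> esub (Suc k) I x = eratio k I x * esub k I x"
  using gcone_esub_pos[of x k I] by (simp add: eratio_def)

lemma eratio_pos: "x \<in> gcone (Suc k) I \<Longrightarrow> 0 < eratio k I x"
  unfolding eratio_def using gcone_esub_pos gcone_Suc_subset by (intro divide_pos_pos) blast+

lemma esub_Suc_factor: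
  assumes "x \<in> gcone k (I - {i})" "i \<in> I"
  shows "esub (Suc k) I x = (x $ i + eratio k (I - {i}) x) * esub k (I - {i}) x"
  using esub_Suc_eq_eratio[OF assms(1)] by (simp add: esub_Suc_remove[OF assms(2)] algebra_simps)

lemma coord_plus_eratio_pos:
  assumes "x \<in> gcone (Suc k) I" "i \<in> I"
  shows "0 < x $ i + eratio k (I - {i}) x"
proof -
  have "x \<in> gcone k (I - {i})" using assms by simp
  then have "0 < (x $ i + eratio k (I - {i}) x) * esub k (I - {i}) x" "0 < esub k (I - {i}) x"
    using assms(1) esub_Suc_factor[OF _ assms(2)] gcone_esub_pos by simp_all
  then show ?thesis by (simp add: zero_less_mult_iff)
qed

text \<open>
  Euler's identity expresses the quotient of one order by the quotients of the previous order with
  one index deleted. The summands have the form \<open>t - t\<^sup>2 / d\<close>, which is concave in \<open>(t, d)\<close> and nondecreasing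
  in \<open>d > 0\<close>. Concavity gives \<open>concave_on_eratio\<close> and monotonicity gives \<open>newton_eratio\<close>.
\<close>
lemma eratio_recursion:
  assumes x: "x \<in> gcone (Suc k) I"
  shows "real (Suc (Suc k)) * eratio (Suc k) I x
       = (\<Sum>i\<in>I. x $ i - (x $ i)\<^sup>2 / (x $ i + eratio k (I - {i}) x))"
proof -
  have E: "0 < esub (Suc k) I x" using x by simp
  have "real (Suc (Suc k)) * eratio (Suc k) I x
      = (\<Sum>i\<in>I. x $ i * esub (Suc k) (I - {i}) x / esub (Suc k) I x)"
    by (simp add: eratio_def sum_coord_esub_remove flip: sum_divide_distrib)
  also have "\<dots> = (\<Sum>i\<in>I. x $ i - (x $ i)\<^sup>2 / (x $ i + eratio k (I - {i}) x))"
  proof (rule sum.cong[OF refl])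
    fix i assume i: "i \<in> I"
    then have xi: "x \<in> gcone k (I - {i})" using x by simp
    let ?e = "esub k (I - {i}) x" and ?r = "eratio k (I - {i}) x"
    have "0 < ?e" "0 < x $ i + ?r"
      using gcone_esub_pos[OF xi] coord_plus_eratio_pos[OF x i] by auto
    moreover have "esub (Suc k) (I - {i}) x = ?r * ?e" by (rule esub_Suc_eq_eratio[OF xi])
    moreover have "esub (Suc k) I x = (x $ i + ?r) * ?e" by (rule esub_Suc_factor[OF xi i])
    ultimately have "x $ i * esub (Suc k) (I - {i}) x / esub (Suc k) I x
        = x $ i * ?r / (x $ i + ?r)"
      by simp
    also have "\<dots> = x $ i - (x $ i)\<^sup>2 / (x $ i + ?r)"
      using \<open>0 < x $ i + ?r\<close> by (simp add: field_simps power2_eq_square)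
    finally show "x $ i * esub (Suc k) (I - {i}) x / esub (Suc k) I x
        = x $ i - (x $ i)\<^sup>2 / (x $ i + ?r)" .
  qed
  finally show ?thesis .
qed

text \<open>
  Joint convexity of \<open>t\<^sup>2 / d\<close> together with its monotonicity in \<open>d\<close>. The gap in the first, multiplied
  by \<open>u * p + v * q\<close>, is \<open>u * v * (a * q - b * p)\<^sup>2 / (p * q)\<close>.
\<close>
lemma square_over_concave:
  fixes u v :: real
  assumes "0 \<le> u" "0 \<le> v" "u + v = 1" "0 < p" "0 < q" "u * p + v * q \<le> r"
  shows "(u * a + v * b)\<^sup>2 / r \<le> u * (a\<^sup>2 / p) + v * (b\<^sup>2 / q)"
proof -
  have pos: "0 < u * p + v * q"
    by (smt (verit, best) assms mult_nonneg_nonneg mult_pos_pos)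
  have "(u * a + v * b)\<^sup>2 / r \<le> (u * a + v * b)\<^sup>2 / (u * p + v * q)"
    using pos assms(6) by (intro divide_left_mono) auto
  also have "\<dots> \<le> u * (a\<^sup>2 / p) + v * (b\<^sup>2 / q)"
  proof -
    have "(u * (a\<^sup>2 / p) + v * (b\<^sup>2 / q)) * (u * p + v * q) - (u * a + v * b)\<^sup>2
        = u * v * (a * q - b * p)\<^sup>2 / (p * q)"
      using assms(4,5) by (simp add: field_simps power2_eq_square)
    moreover have "0 \<le> u * v * (a * q - b * p)\<^sup>2 / (p * q)" using assms by simp
    ultimately show ?thesis using pos by (simp add: pos_divide_le_eq)
  qed
  finally show ?thesis .
qed

text \<open>
  Induction on \<open>k\<close> proves the convexity of the cone at the same time: by \<open>esub_Suc_factor\<close>, membership in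
  \<open>gcone (Suc k) I\<close> means membership in each \<open>gcone k (I - {i})\<close> and positivity of
  \<open>x\<^sub>i + eratio k (I - {i}) x\<close>, which is concave by the induction hypothesis.
\<close>
lemma concave_on_eratio: "concave_on (gcone k I) (eratio k I)"
proof (induction k arbitrary: I)
  case 0
  have "eratio 0 I = (\<lambda>x. \<Sum>i\<in>I. x $ i)" by (simp add: fun_eq_iff eratio_def esub_1)
  then show ?case
    by (simp add: concave_on_iff sum.distrib sum_distrib_left)
next
  case (Suc k)
  have combination: "u *\<^sub>R x + v *\<^sub>R y \<in> gcone (Suc k) I \<and>
      u * eratio (Suc k) I x + v * eratio (Suc k) I y \<le> eratio (Suc k) I (u *\<^sub>R x + v *\<^sub>R y)"
    if x: "x \<in> gcone (Suc k) I" and y: "y \<in> gcone (Suc k) I" and uv: "0 \<le> u" "0 \<le> v" "u + v = 1"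
    for x y u v
  proof -
    let ?z = "u *\<^sub>R x + v *\<^sub>R y"
    let ?d = "\<lambda>i w. w $ i + eratio k (I - {i}) w"
    have d: "u * ?d i x + v * ?d i y \<le> ?d i ?z" "0 < ?d i x" "0 < ?d i y"
      and z_rem: "?z \<in> gcone k (I - {i})" if i: "i \<in> I" for i
    proof -
      have mem: "x \<in> gcone k (I - {i})" "y \<in> gcone k (I - {i})" using x y i by auto
      then have "u * eratio k (I - {i}) x + v * eratio k (I - {i}) y \<le> eratio k (I - {i}) ?z"
        using Suc[of "I - {i}"] uv unfolding concave_on_iff by blast
      then show "u * ?d i x + v * ?d i y \<le> ?d i ?z" by (simp add: algebra_simps)
      show "?z \<in> gcone k (I - {i})"
        using mem uv Suc[of "I - {i}"] by (simp add: concave_on_iff convex_def)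
      show "0 < ?d i x" "0 < ?d i y" using coord_plus_eratio_pos x y i by blast+
    qed
    have d_pos: "0 < ?d i ?z" if "i \<in> I" for i
      by (smt (verit, best) d[OF that] uv mult_nonneg_nonneg mult_pos_pos)
    have "I \<noteq> {}" using gcone_card[OF x] by auto
    then obtain i where i: "i \<in> I" by blast
    then have "0 < esub (Suc k) I ?z"
      using d_pos[OF i] gcone_esub_pos[OF z_rem[OF i]] esub_Suc_factor[OF z_rem[OF i] i] by simp
    then have z: "?z \<in> gcone (Suc k) I" using z_rem by simp
    let ?t = "\<lambda>i w. w $ i - (w $ i)\<^sup>2 / ?d i w"
    have "(\<Sum>i\<in>I. u * ?t i x + v * ?t i y) \<le> (\<Sum>i\<in>I. ?t i ?z)"
    proof (rule sum_mono)
      fix i assume i: "i \<in> I"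
      have "(?z $ i)\<^sup>2 / ?d i ?z \<le> u * ((x $ i)\<^sup>2 / ?d i x) + v * ((y $ i)\<^sup>2 / ?d i y)"
        using square_over_concave[OF uv d(2)[OF i] d(3)[OF i] d(1)[OF i], of "x $ i" "y $ i"] by simp
      then show "u * ?t i x + v * ?t i y \<le> ?t i ?z" by (simp add: algebra_simps)
    qed
    then have "u * (\<Sum>i\<in>I. ?t i x) + v * (\<Sum>i\<in>I. ?t i y) \<le> (\<Sum>i\<in>I. ?t i ?z)"
      by (simp only: sum.distrib sum_distrib_left)
    then have "real (Suc (Suc k)) * (u * eratio (Suc k) I x + v * eratio (Suc k) I y)
        \<le> real (Suc (Suc k)) * eratio (Suc k) I ?z"
      unfolding eratio_recursion[OF x, symmetric] eratio_recursion[OF y, symmetric]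
        eratio_recursion[OF z, symmetric] by (simp only: algebra_simps)
    then show ?thesis using z by (subst (asm) mult_le_cancel_left_pos) auto
  qed
  then have "convex (gcone (Suc k) I)" unfolding convex_def by blast
  then show ?case unfolding concave_on_iff using combination by blast
qed

text \<open>
  Newton's inequality in a form whose constants do not depend on the number of indices. The right-hand
  side of \<open>eratio_recursion\<close> does not decrease when the quotients in it grow, so the order of the quotients for
  \<open>I - {i}\<close> is inherited by those for \<open>I\<close>.
\<close>
lemma newton_eratio:
  assumes "x \<in> gcone (Suc k) I"
  shows "real (Suc (Suc k)) * eratio (Suc k) I x \<le> real (Suc k) * eratio k I x"
  using assms
proof (induction k arbitrary: I)
  case 0
  have "real (Suc (Suc 0)) * eratio (Suc 0) I x
      = (\<Sum>i\<in>I. x $ i - (x $ i)\<^sup>2 / (x $ i + eratio 0 (I - {i}) x))"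
    by (rule eratio_recursion[OF 0])
  also have "\<dots> \<le> (\<Sum>i\<in>I. x $ i)"
    using coord_plus_eratio_pos[OF 0] by (intro sum_mono) (simp add: less_imp_le)
  finally show ?case by (simp add: eratio_def esub_1)
next
  case (Suc k)
  have x': "x \<in> gcone (Suc k) I" using Suc.prems gcone_Suc_subset by blast
  have "real (Suc (Suc (Suc k))) * eratio (Suc (Suc k)) I x
      = (\<Sum>i\<in>I. x $ i - (x $ i)\<^sup>2 / (x $ i + eratio (Suc k) (I - {i}) x))"
    by (rule eratio_recursion[OF Suc.prems])
  also have "\<dots> \<le> (\<Sum>i\<in>I. x $ i - (x $ i)\<^sup>2 / (x $ i + eratio k (I - {i}) x))"
  proof (rule sum_mono)
    fix i assume i: "i \<in> I"
    let ?r = "eratio k (I - {i}) x" and ?r' = "eratio (Suc k) (I - {i}) x"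
    have xi: "x \<in> gcone (Suc k) (I - {i})" by (rule gcone_remove[OF Suc.prems i])
    have "real (Suc (Suc k)) * ?r' \<le> real (Suc k) * ?r" by (rule Suc.IH[OF xi])
    also have "\<dots> \<le> real (Suc (Suc k)) * ?r"
      using eratio_pos[OF xi] by (intro mult_right_mono) auto
    \<comment> \<open>As the quotient is positive, the smaller factor \<open>k + 1\<close> may be replaced by \<open>k + 2\<close>.\<close>
    finally have "?r' \<le> ?r" by (subst (asm) mult_le_cancel_left_pos) auto
    moreover have "0 < x $ i + ?r'" by (rule coord_plus_eratio_pos[OF Suc.prems i])
    ultimately have "(x $ i)\<^sup>2 / (x $ i + ?r) \<le> (x $ i)\<^sup>2 / (x $ i + ?r')"
      by (intro divide_left_mono) auto
    then show "x $ i - (x $ i)\<^sup>2 / (x $ i + ?r') \<le> x $ i - (x $ i)\<^sup>2 / (x $ i + ?r)" by simp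
  qed
  also have "\<dots> = real (Suc (Suc k)) * eratio (Suc k) I x"
    by (rule eratio_recursion[OF x', symmetric])
  finally show ?case .
qed

lemma eratio_Suc_le:
  assumes "x \<in> gcone (Suc k) I"
  shows "eratio (Suc k) I x \<le> eratio k I x"
proof -
  have "real (Suc (Suc k)) * eratio (Suc k) I x \<le> real (Suc k) * eratio k I x"
    by (rule newton_eratio[OF assms])
  also have "\<dots> \<le> real (Suc (Suc k)) * eratio k I x"
    using eratio_pos[OF assms] by (intro mult_right_mono) auto
  finally show ?thesis by (subst (asm) mult_le_cancel_left_pos) auto
qed

lemma eratio_le_sum:
  assumes "x \<in> gcone k I"
  shows "eratio k I x \<le> (\<Sum>i\<in>I. x $ i)"
  using assms
proof (induction k)
  case (Suc k)
  then show ?case using eratio_Suc_le[OF Suc.prems] gcone_Suc_subset by fastforce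
qed (simp add: eratio_def esub_1)

lemma sum_coord_pos: "\<lbrakk>x \<in> gcone k I; k \<noteq> 0\<rbrakk> \<Longrightarrow> 0 < (\<Sum>i\<in>I. x $ i)"
  using gcone_antimono[of "Suc 0" k I] gcone_esub_pos[of x "Suc 0" I]
  by (auto simp: esub_1 Suc_le_eq)

text \<open>
  Each step from \<open>k\<close> up to \<open>m\<close> multiplies by a quotient that is at most the sum of the coordinates.
\<close>
lemma esub_le_power_sum:
  assumes "x \<in> gcone m I" "k \<le> m"
  shows "esub m I x \<le> (\<Sum>i\<in>I. x $ i) ^ (m - k) * esub k I x"
  using assms(2,1)
proof (induction m rule: dec_induct)
  case (step m)
  have x: "x \<in> gcone m I" using step.prems gcone_Suc_subset by blast
  have "esub (Suc m) I x = eratio m I x * esub m I x" by (rule esub_Suc_eq_eratio[OF x])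
  also have "\<dots> \<le> (\<Sum>i\<in>I. x $ i) * ((\<Sum>i\<in>I. x $ i) ^ (m - k) * esub k I x)"
  proof (rule mult_mono)
    show "eratio m I x \<le> (\<Sum>i\<in>I. x $ i)" by (rule eratio_le_sum[OF x])
    show "esub m I x \<le> (\<Sum>i\<in>I. x $ i) ^ (m - k) * esub k I x" by (rule step.IH[OF x])
    show "0 \<le> (\<Sum>i\<in>I. x $ i)" using sum_coord_pos[OF step.prems] by simp
    show "0 \<le> esub m I x" using gcone_esub_pos[OF x] by simp
  qed
  finally show ?case using step.hyps by (simp add: Suc_diff_le mult.assoc)
qed simp

text \<open>
  The polynomial is a product of quotients of which the last is the smallest.
\<close>
lemma eratio_power_le_esub:
  assumes "x \<in> gcone (Suc m) I"
  shows "eratio m I x ^ Suc m \<le> esub (Suc m) I x"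
  using assms
proof (induction m)
  case (Suc m)
  have x: "x \<in> gcone (Suc m) I" using Suc.prems gcone_Suc_subset by blast
  have r: "0 < eratio (Suc m) I x" by (rule eratio_pos[OF Suc.prems])
  have "eratio (Suc m) I x ^ Suc m \<le> eratio m I x ^ Suc m"
    using eratio_Suc_le[OF x] r by (intro power_mono) auto
  also have "\<dots> \<le> esub (Suc m) I x" by (rule Suc.IH[OF x])
  finally have "eratio (Suc m) I x * eratio (Suc m) I x ^ Suc m
      \<le> eratio (Suc m) I x * esub (Suc m) I x"
    using r by simp
  then show ?case using esub_Suc_eq_eratio[OF x] by simp
qed (simp add: eratio_def)

text \<open>
  The quotient is a product of positive concave functions, and each of these is log-concave.
\<close>
lemma concave_on_ln_esub_quotient:
  assumes "k \<le> m"
  shows "concave_on (gcone m I) (\<lambda>x. ln (esub m I x / esub k I x))"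
  using assms
proof (induction m rule: dec_induct)
  case base
  have "convex (gcone k I)" using concave_on_eratio concave_on_imp_convex by blast
  moreover have "ln (esub k I x / esub k I x) = 0" for x by (cases "esub k I x = 0") auto
  ultimately show ?case by (simp add: concave_on_const)
next
  case (step m)
  let ?G = "gcone (Suc m) I"
  have conv: "convex ?G" using concave_on_eratio concave_on_imp_convex by blast
  have sub: "?G \<subseteq> gcone m I" by (rule gcone_Suc_subset)
  have "concave_on ?G (\<lambda>x. ln (eratio m I x))"
    unfolding concave_on_iff
  proof (intro conjI ballI allI impI conv)
    fix x y and u v :: real
    assume x: "x \<in> ?G" and y: "y \<in> ?G" and uv: "0 \<le> u" "0 \<le> v" "u + v = 1"
    have p: "0 < eratio m I x" "0 < eratio m I y" using x y eratio_pos by blast+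
    have le: "u * eratio m I x + v * eratio m I y \<le> eratio m I (u *\<^sub>R x + v *\<^sub>R y)"
      using concave_on_eratio[of m I] sub x y uv unfolding concave_on_iff by blast
    have pos: "0 < u * eratio m I x + v * eratio m I y"
      by (smt (verit, best) p uv mult_nonneg_nonneg mult_pos_pos)
    have "u * ln (eratio m I x) + v * ln (eratio m I y) \<le> ln (u * eratio m I x + v * eratio m I y)"
      using ln_concave p uv unfolding concave_on_iff by simp
    also have "\<dots> \<le> ln (eratio m I (u *\<^sub>R x + v *\<^sub>R y))"
      using le pos by simp
    finally show "u * ln (eratio m I x) + v * ln (eratio m I y)
        \<le> ln (eratio m I (u *\<^sub>R x + v *\<^sub>R y))" .
  qed
  moreover have "concave_on ?G (\<lambda>x. ln (esub m I x / esub k I x))"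
    using step.IH sub conv unfolding concave_on_iff by blast
  ultimately have c: "concave_on ?G (\<lambda>x. ln (eratio m I x) + ln (esub m I x / esub k I x))"
    by (rule concave_on_add)
  have eq: "ln (esub (Suc m) I x / esub k I x) = ln (eratio m I x) + ln (esub m I x / esub k I x)"
    if "x \<in> ?G" for x
  proof -
    have "0 < esub k I x" "0 < esub m I x" "0 < eratio m I x"
      using that gcone_antimono[of k "Suc m" I] step.hyps(1) sub gcone_esub_pos[of x]
        eratio_pos[OF that] by (auto simp del: gcone.simps)
    moreover have "esub (Suc m) I x / esub k I x = eratio m I x * (esub m I x / esub k I x)"
      using esub_Suc_eq_eratio[OF subsetD[OF sub that]] by simp
    ultimately show ?thesis by (metis divide_pos_pos ln_mult_pos)
  qed
  from c show ?case using conv unfolding concave_on_iff convex_def by (simp add: eq del: gcone.simps)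
qed

lemma convex_on_esub_quotient:
  assumes "k \<le> m"
  shows "convex_on (gcone m I) (\<lambda>x. esub k I x / esub m I x)"
proof -
  have conv: "convex (gcone m I)" using concave_on_eratio concave_on_imp_convex by blast
  let ?l = "\<lambda>x. ln (esub m I x / esub k I x)"
  have eq: "esub k I x / esub m I x = exp (- ?l x)" if "x \<in> gcone m I" for x
  proof -
    have "0 < esub k I x" "0 < esub m I x"
      using that gcone_antimono[OF assms] gcone_esub_pos by blast+
    then show ?thesis by (simp add: exp_minus)
  qed
  show ?thesis
    unfolding convex_on_def
  proof (intro conjI ballI allI impI conv)
    fix x y and u v :: real
    assume x: "x \<in> gcone m I" and y: "y \<in> gcone m I" and uv: "0 \<le> u" "0 \<le> v" "u + v = 1"
    let ?z = "u *\<^sub>R x + v *\<^sub>R y"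
    have z: "?z \<in> gcone m I" using conv x y uv by (simp add: convex_def)
    have "u * ?l x + v * ?l y \<le> ?l ?z"
      using concave_on_ln_esub_quotient[OF assms, of I] x y uv unfolding concave_on_iff by blast
    then have "exp (- ?l ?z) \<le> exp (u * (- ?l x) + v * (- ?l y))" by simp
    also have "\<dots> \<le> u * exp (- ?l x) + v * exp (- ?l y)"
      using exp_convex uv unfolding convex_on_def real_scaleR_def by blast
    finally show "esub k I ?z / esub m I ?z
        \<le> u * (esub k I x / esub m I x) + v * (esub k I y / esub m I y)"
      by (simp only: eq[OF x] eq[OF y] eq[OF z])
  qed
qed

text \<open>
  This inequality between polynomials survives the passage to the closure of the cone, where it
  shows that a partial derivative cannot vanish before the polynomial itself does.
\<close>
lemma esub_le_sum_mult_esub_remove: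
  assumes x: "x \<in> gcone (Suc k) I" and i: "i \<in> I"
  shows "esub (Suc k) I x \<le> (\<Sum>j\<in>I. x $ j) * esub k (I - {i}) x"
proof -
  have xi: "x \<in> gcone k (I - {i})" by (rule gcone_remove[OF x i])
  have "x $ i + eratio k (I - {i}) x \<le> x $ i + (\<Sum>j\<in>I - {i}. x $ j)"
    using eratio_le_sum[OF xi] by simp
  also have "\<dots> = (\<Sum>j\<in>I. x $ j)" using i by (simp add: sum.remove)
  finally show ?thesis
    using gcone_esub_pos[OF xi] by (simp add: esub_Suc_factor[OF xi i] mult_right_mono)
qed

lemma le_on_closure:
  fixes f g :: "real ^ 'n \<Rightarrow> real"
  assumes "\<And>y. y \<in> A \<Longrightarrow> f y \<le> g y" "continuous_on UNIV f" "continuous_on UNIV g" "x \<in> closure A"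
  shows "f x \<le> g x"
proof -
  have "closed {y. f y \<le> g y}" using assms(2,3) by (rule closed_Collect_le)
  then have "closure A \<subseteq> {y. f y \<le> g y}" using assms(1) by (intro closure_minimal) auto
  then show ?thesis using assms(4) by blast
qed

text \<open>
  On the boundary of the cone it is \<open>esub k I\<close> itself that vanishes, not merely one of its partial
  derivatives.
\<close>
lemma closure_gcone_esub_pos:
  assumes "x \<in> closure (gcone k I)" "0 < esub k I x"
  shows "x \<in> gcone k I"
  using assms
proof (induction k arbitrary: I)
  case (Suc k)
  have "x \<in> gcone k (I - {i})" if i: "i \<in> I" for i
  proof (rule Suc.IH)
    have "gcone (Suc k) I \<subseteq> gcone k (I - {i})" using i by auto
    then show cl: "x \<in> closure (gcone k (I - {i}))" using Suc.prems(1) closure_mono by blast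
    have "esub (Suc k) I x \<le> (\<Sum>j\<in>I. x $ j) * esub k (I - {i}) x"
      by (rule le_on_closure[OF esub_le_sum_mult_esub_remove[OF _ i] _ _ Suc.prems(1)])
        (auto intro!: continuous_intros)
    moreover have "0 \<le> esub k (I - {i}) x"
      by (rule le_on_closure[OF _ _ _ cl]) (auto intro!: continuous_intros less_imp_le gcone_esub_pos)
    ultimately show "0 < esub k (I - {i}) x"
      using Suc.prems(2) by (cases "esub k (I - {i}) x = 0") auto
  qed
  then show ?case using Suc.prems(2) by simp
qed simp

section \<open>Components of sets defined by coordinatewise affine functions\<close>

lemma clopen_connected_in_components:
  assumes "connected A" "A \<noteq> {}" "openin (top_of_set Z) A" "closedin (top_of_set Z) A"
  shows "A \<in> components Z"
proof -
  have AZ: "A \<subseteq> Z" using assms(3) by (rule openin_imp_subset)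
  then obtain K where K: "K \<in> components Z" "A \<subseteq> K"
    using exists_component_superset[of A Z] assms(1,2) by blast
  have "openin (top_of_set K) A" "closedin (top_of_set K) A"
    using assms(3,4) K in_components_subset[OF K(1)]
    by (meson openin_subset_trans closedin_subset_trans)+
  then have "A = K"
    using in_components_connected[OF K(1)] assms(2) unfolding connected_clopen by blast
  then show ?thesis using K by simp
qed

lemma in_orthant_translate_iff: "in_orthant_translate S \<longleftrightarrow> (\<exists>q. \<forall>x\<in>S. \<forall>i. q $ i < x $ i)"
proof -
  have "S \<subseteq> (\<lambda>x. q + x) ` pos_orthant \<longleftrightarrow> (\<forall>x\<in>S. \<forall>i. q $ i < x $ i)" for q :: "real ^ 'a"
  proof
    assume "\<forall>x\<in>S. \<forall>i. q $ i < x $ i"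
    then have "x - q \<in> pos_orthant" if "x \<in> S" for x using that by (simp add: pos_orthant_def)
    then show "S \<subseteq> (\<lambda>x. q + x) ` pos_orthant" by force
  qed (auto simp: pos_orthant_def)
  then show ?thesis by (simp add: in_orthant_translate_def)
qed

text \<open>
  The slope \<open>d\<close> may depend on \<open>x\<close>; polynomials of degree at most one in each variable have this property.
\<close>
definition coord_affine :: "(real ^ 'n \<Rightarrow> real) \<Rightarrow> bool" where
  "coord_affine f \<longleftrightarrow> (\<forall>x i. \<exists>d. \<forall>t. f (x + t *\<^sub>R axis i 1) = f x + t * d)"

lemma coord_affineD:
  assumes "coord_affine f"
  shows "f (x + t *\<^sub>R axis i 1) = f x + t * (f (x + axis i 1) - f x)"
proof -
  obtain d where d: "\<And>t. f (x + t *\<^sub>R axis i 1) = f x + t * d"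
    using assms unfolding coord_affine_def by blast
  from d[of t] d[of 1] show ?thesis by simp
qed

lemma coord_affine_add:
  assumes "coord_affine f" "coord_affine g"
  shows "coord_affine (\<lambda>x. f x + g x)"
  unfolding coord_affine_def coord_affineD[OF assms(1)] coord_affineD[OF assms(2)]
  by (auto simp: distrib_left[symmetric])

lemma coord_affine_cmult:
  assumes "coord_affine f"
  shows "coord_affine (\<lambda>x. a * f x)"
  unfolding coord_affine_def coord_affineD[OF assms]
  by (auto simp: distrib_left mult.left_commute[of a])

lemma coord_affine_diff: "\<lbrakk>coord_affine f; coord_affine g\<rbrakk> \<Longrightarrow> coord_affine (\<lambda>x. f x - g x)"
  using coord_affine_add[of f "\<lambda>x. - 1 * g x"] coord_affine_cmult[of g "- 1"] by simp

lemma coord_affine_sum: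
  "(\<And>k. k \<in> A \<Longrightarrow> coord_affine (F k)) \<Longrightarrow> coord_affine (\<lambda>x. \<Sum>k\<in>A. F k x)"
  by (induction A rule: infinite_finite_induct)
    (simp_all add: coord_affine_add, simp_all add: coord_affine_def)

lemma esub_cong: "(\<And>i. i \<in> I \<Longrightarrow> x $ i = y $ i) \<Longrightarrow> esub k I x = esub k I y"
  unfolding esub_def by (intro sum.cong prod.cong) auto

lemma coord_affine_esub: "coord_affine (esub k I)"
  unfolding coord_affine_def
proof (intro allI)
  fix x :: "real ^ 'a" and i
  have other: "esub l (I - {i}) (x + t *\<^sub>R axis i 1) = esub l (I - {i}) x" for l t
    by (rule esub_cong) (simp add: axis_def)
  show "\<exists>d. \<forall>t. esub k I (x + t *\<^sub>R axis i 1) = esub k I x + t * d"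
  proof (cases "i \<in> I \<and> k \<noteq> 0")
    case True
    then obtain m where i: "i \<in> I" and m: "k = Suc m" by (cases k) auto
    have "esub k I (x + t *\<^sub>R axis i 1) = esub k I x + t * esub m (I - {i}) x" for t
      unfolding m esub_Suc_remove[OF i] other by (simp add: algebra_simps)
    then show ?thesis by blast
  next
    case False
    have "esub k I (x + t *\<^sub>R axis i 1) = esub k I x" for t
    proof (cases "k = 0")
      case False
      then have "I - {i} = I" using \<open>\<not> (i \<in> I \<and> k \<noteq> 0)\<close> by simp
      then show ?thesis using other[of k t] by simp
    qed simp
    then show ?thesis by (intro exI[of _ 0]) simp
  qed
qed

text \<open>
  If the slope in the direction \<open>i\<close> were negative at \<open>x\<close>, the ray from \<open>x\<close> to minus infinity in that
  direction would stay in \<open>{f > 0}\<close> and hence in \<open>D\<close>, which is bounded below. With a nonnegative slope the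
  opposite ray stays in \<open>D\<close>.
\<close>
lemma positive_component_up:
  assumes f: "coord_affine f" and D: "is_positive_region f D"
    and x: "x \<in> D" and t: "0 \<le> t"
  shows "x + t *\<^sub>R axis i 1 \<in> D"
proof -
  have comp: "D \<in> components {x. 0 < f x}" using D by (simp add: is_positive_region_def)
  obtain q where q: "\<And>y j. y \<in> D \<Longrightarrow> q $ j < y $ j"
    using D unfolding is_positive_region_def in_orthant_translate_iff by blast
  let ?p = "\<lambda>s. x + s *\<^sub>R axis i (1::real)" and ?d = "f (x + axis i 1) - f x"
  have fx: "0 < f x" using x in_components_subset[OF comp] by blast
  have ray: "?p ` K \<subseteq> D" if "convex K" "0 \<in> K" "\<And>s. s \<in> K \<Longrightarrow> 0 \<le> s * ?d" for K
  proof (rule components_maximal[OF comp])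
    show "connected (?p ` K)"
      using that(1) by (intro connected_continuous_image convex_connected continuous_intros)
    show "?p ` K \<subseteq> {x. 0 < f x}"
      using fx that(3) by (force simp: coord_affineD[OF f] intro: add_pos_nonneg)
    show "D \<inter> ?p ` K \<noteq> {}" using x that(2) by force
  qed
  have "0 \<le> ?d"
  proof (rule ccontr)
    assume "\<not> 0 \<le> ?d"
    then have "?p ` {..0} \<subseteq> D" by (intro ray) (auto simp: mult_nonpos_nonpos)
    moreover have "q $ i - x $ i \<le> 0" using q[OF x, of i] by simp
    ultimately have "?p (q $ i - x $ i) \<in> D" by blast
    from q[OF this, of i] show False by (simp add: axis_def)
  qed
  then have "?p ` {0..} \<subseteq> D" by (intro ray) auto
  then show ?thesis using t by auto
qed

lemma positive_region_upward_closed: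
  fixes f :: "real ^ 'n::finite \<Rightarrow> real"
  assumes f: "coord_affine f" and D: "is_positive_region f D"
    and x: "x \<in> D" and le: "\<And>i. x $ i \<le> y $ i"
  shows "y \<in> D"
proof -
  \<comment> \<open>The coordinates are raised one at a time, from those of \<open>x\<close> to those of \<open>y\<close>.\<close>
  let ?y = "\<lambda>A. (\<chi> i. if i \<in> A then y $ i else x $ i) :: real ^ 'n"
  have "?y A \<in> D" if "finite A" for A
    using that
  proof (induction A)
    case (insert i A)
    have "?y (insert i A) = ?y A + (y $ i - x $ i) *\<^sub>R axis i 1"
      using insert.hyps by (auto simp: vec_eq_iff axis_def)
    then show ?case
      using positive_component_up[OF f D insert.IH, of "y $ i - x $ i" i] le[of i] by simp
  qed (simp add: x)
  from this[of UNIV] show ?thesis by simp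
qed

lemma positive_region_unique:
  fixes f :: "real ^ 'n::finite \<Rightarrow> real"
  assumes f: "coord_affine f" and D: "is_positive_region f D" and D': "is_positive_region f D'"
  shows "D = D'"
proof -
  have comp: "D \<in> components {x. 0 < f x}" "D' \<in> components {x. 0 < f x}"
    using D D' by (auto simp: is_positive_region_def)
  then obtain x x' where x: "x \<in> D" "x' \<in> D'" using in_components_nonempty by blast
  let ?y = "(\<chi> i. max (x $ i) (x' $ i)) :: real ^ 'n"
  have "?y \<in> D" "?y \<in> D'"
    using positive_region_upward_closed[OF f D x(1), of ?y]
      positive_region_upward_closed[OF f D' x(2), of ?y] by auto
  then show ?thesis using components_eq[OF comp] by blast
qed

text \<open>
  In the plane through \<open>x\<close> spanned by the directions \<open>i\<close> and \<open>j\<close>, the zero set is given by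
  \<open>s * \<alpha> + r * (\<beta> + s * \<delta>) = 0\<close>. Wherever the slope \<open>\<beta> + s * \<delta>\<close> is nonzero, this is the graph of a
  function of \<open>s\<close>. A zero of the slope at \<open>s = 0\<close> would put a whole line into the component. As the slope
  is affine in \<open>s\<close>, a zero at some \<open>s > 0\<close> would leave none for \<open>s \<le> 0\<close>, and the graph would reach
  minus infinity in the direction \<open>i\<close>. So the graph exists for all \<open>s \<ge> 0\<close>.
\<close>
lemma level_set_slide:
  assumes f: "coord_affine f" and T: "is_level_set f T"
    and x: "x \<in> T" and ij: "i \<noteq> j" and t: "0 \<le> t"
  shows "\<exists>s. x + t *\<^sub>R axis i 1 + s *\<^sub>R axis j 1 \<in> T"
proof -
  have comp: "T \<in> components {x. f x = 0}" using T by (simp add: is_level_set_def)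
  obtain q where q: "\<And>y j. y \<in> T \<Longrightarrow> q $ j < y $ j"
    using T unfolding is_level_set_def in_orthant_translate_iff by blast
  have fx: "f x = 0" using x in_components_subset[OF comp] by blast
  define \<alpha> where "\<alpha> = f (x + axis i 1)"
  define \<beta> where "\<beta> = f (x + axis j 1)"
  define \<delta> where "\<delta> = f (x + axis i 1 + axis j 1) - \<alpha> - \<beta>"
  have plane: "f (x + s *\<^sub>R axis i 1 + r *\<^sub>R axis j 1) = s * \<alpha> + r * (\<beta> + s * \<delta>)" for s r
  proof -
    have "f (x + s *\<^sub>R axis i 1 + axis j 1) = f (x + axis j 1 + s *\<^sub>R axis i 1)"
      by (simp add: algebra_simps)
    also have "\<dots> = \<beta> + s * (\<alpha> + \<delta>)"
      unfolding coord_affineD[OF f] \<beta>_def \<delta>_def by (simp add: algebra_simps)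
    finally show ?thesis
      unfolding coord_affineD[OF f, of "x + s *\<^sub>R axis i 1"] coord_affineD[OF f, of x s] fx \<alpha>_def
      by (simp add: algebra_simps)
  qed
  let ?p = "\<lambda>s. x + s *\<^sub>R axis i 1 + (- (s * \<alpha>) / (\<beta> + s * \<delta>)) *\<^sub>R axis j 1"
  have curve: "?p ` K \<subseteq> T" if "convex K" "0 \<in> K" "\<And>s. s \<in> K \<Longrightarrow> \<beta> + s * \<delta> \<noteq> 0" for K
  proof (rule components_maximal[OF comp])
    show "connected (?p ` K)"
      using that by (intro connected_continuous_image convex_connected continuous_intros) auto
    have "f (?p s) = 0" if "s \<in> K" for s
      unfolding plane using \<open>\<And>s. s \<in> K \<Longrightarrow> \<beta> + s * \<delta> \<noteq> 0\<close>[OF that] by simp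
    then show "?p ` K \<subseteq> {x. f x = 0}" by blast
    show "T \<inter> ?p ` K \<noteq> {}" using x that(2) by force
  qed
  have \<beta>: "\<beta> \<noteq> 0"
  proof
    assume "\<beta> = 0"
    \<comment> \<open>The line in the direction \<open>j\<close> lies in the zero set.\<close>
    let ?l = "\<lambda>r. x + r *\<^sub>R axis j (1::real)"
    have "range ?l \<subseteq> T"
    proof (rule components_maximal[OF comp])
      show "connected (range ?l)"
        by (intro connected_continuous_image convex_connected continuous_intros) simp
      show "range ?l \<subseteq> {x. f x = 0}" using plane[of 0] \<open>\<beta> = 0\<close> by auto
      show "T \<inter> range ?l \<noteq> {}" using x by (force intro: range_eqI[where x = 0])
    qed
    then have "?l (q $ j - x $ j) \<in> T" by blast
    from q[OF this, of j] show False by (simp add: axis_def)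
  qed
  have "\<beta> + s * \<delta> \<noteq> 0" if s: "0 \<le> s" for s
  proof
    assume root: "\<beta> + s * \<delta> = 0"
    have "\<beta> + r * \<delta> \<noteq> 0" if "r \<le> 0" for r
    proof
      assume "\<beta> + r * \<delta> = 0"
      then have "(s - r) * \<delta> = 0" using root unfolding left_diff_distrib by linarith
      then show False using root \<beta> s that by auto
    qed
    then have "?p ` {..0} \<subseteq> T" by (intro curve) auto
    moreover have "q $ i - x $ i \<le> 0" using q[OF x, of i] by simp
    ultimately have "?p (q $ i - x $ i) \<in> T" by blast
    from q[OF this, of i] show False using ij by (simp add: axis_def)
  qed
  then have "?p ` {0..} \<subseteq> T" by (intro curve) auto
  then have "?p t \<in> T" using t by blast
  then show ?thesis by blast
qed

text \<open>
  The coordinate \<open>j\<close> absorbs all the adjustments, so the coordinates that are already large stay so.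
\<close>
lemma level_set_far_point:
  fixes f :: "real ^ 'n::finite \<Rightarrow> real"
  assumes f: "coord_affine f" and T: "is_level_set f T"
  shows "\<exists>y\<in>T. \<forall>i. i \<noteq> j \<longrightarrow> M \<le> y $ i"
proof -
  have "\<exists>y\<in>T. \<forall>i\<in>A. M \<le> y $ i" if "finite A" "j \<notin> A" for A
    using that
  proof (induction A)
    case empty
    then show ?case using T in_components_nonempty by (auto simp: is_level_set_def)
  next
    case (insert i A)
    then obtain y where y: "y \<in> T" "\<forall>i\<in>A. M \<le> y $ i" by auto
    obtain s where s: "y + max 0 (M - y $ i) *\<^sub>R axis i 1 + s *\<^sub>R axis j 1 \<in> T"
      using level_set_slide[OF f T y(1), of i j "max 0 (M - y $ i)"] insert.prems by auto
    have "M \<le> (y + max 0 (M - y $ i) *\<^sub>R axis i 1 + s *\<^sub>R axis j 1) $ l" if "l \<in> insert i A" for l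
      using that y(2) insert.prems by (auto simp: axis_def)
    then show ?case using s by blast
  qed
  from this[of "UNIV - {j}"] show ?thesis by auto
qed

text \<open>
  The complement of \<open>C\<close> is connected, because any two of its points can be joined through their
  coordinatewise minimum. The nearest-point projection onto the closure of \<open>C\<close> maps it continuously
  onto the frontier.
\<close>
lemma connected_frontier_upward_closed:
  fixes C :: "(real ^ 'n::finite) set"
  assumes C: "open C" "convex C" "C \<noteq> {}"
    and up: "\<And>x y. \<lbrakk>x \<in> C; \<And>i. x $ i \<le> y $ i\<rbrakk> \<Longrightarrow> y \<in> C"
  shows "connected (frontier C)"
proof -
  have down: "closed_segment x z \<subseteq> - C" if x: "x \<in> - C" and zx: "\<And>i. z $ i \<le> x $ i" for x z
  proof
    fix p assume "p \<in> closed_segment x z"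
    then obtain u where u: "0 \<le> u" "u \<le> 1" "p = (1 - u) *\<^sub>R x + u *\<^sub>R z"
      by (auto simp: closed_segment_def)
    have "p $ i \<le> x $ i" for i
      using mult_left_mono[OF zx[of i] u(1)] by (simp add: u(3) algebra_simps)
    then show "p \<in> - C" using up[of p x] x by blast
  qed
  have "connected (- C)"
    unfolding connected_iff_connected_component
  proof (intro ballI)
    fix x y assume xy: "x \<in> - C" "y \<in> - C"
    let ?z = "(\<chi> i. min (x $ i) (y $ i)) :: real ^ 'n"
    have "connected (closed_segment x ?z \<union> closed_segment y ?z)"
      by (rule connected_Un) auto
    moreover have "closed_segment x ?z \<union> closed_segment y ?z \<subseteq> - C"
      using down[OF xy(1), of ?z] down[OF xy(2), of ?z] by auto
    ultimately show "connected_component (- C) x y" unfolding connected_component_def by blast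
  qed
  moreover have "continuous_on (- C) (closest_point (closure C))"
    using C by (intro continuous_on_closest_point) auto
  moreover have "closest_point (closure C) ` (- C) = frontier C"
  proof (intro equalityI subsetI)
    fix p assume "p \<in> closest_point (closure C) ` (- C)"
    then obtain x where x: "x \<notin> C" "p = closest_point (closure C) x" by auto
    \<comment> \<open>A point outside the interior has its nearest point outside the interior.\<close>
    have rel: "rel_interior (closure C) = C"
      using C by (metis convex_closure_interior convex_rel_interior_closure interior_open
          rel_interior_open)
    have full: "affine hull (closure C) = UNIV"
      using C by (simp add: affine_hull_open)
    have "p \<notin> C"
      using closest_point_in_rel_interior[of "closure C" x] C x rel full by auto
    moreover have "p \<in> closure C" using C x(2) by (simp add: closest_point_in_set)
    ultimately show "p \<in> frontier C" using C(1) by (simp add: frontier_def interior_open)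
  next
    fix p assume p: "p \<in> frontier C"
    then have "p \<in> closure C" "p \<notin> C" using C(1) by (auto simp: frontier_def interior_open)
    then show "p \<in> closest_point (closure C) ` (- C)"
      using closest_point_self[of p "closure C"] by (metis ComplI image_eqI)
  qed
  ultimately show ?thesis using connected_continuous_image by metis
qed

section \<open>The region bounded by the level set\<close>

lemma convex_on_sum_fun:
  assumes "finite A" "convex S" "\<And>k. k \<in> A \<Longrightarrow> convex_on S (F k)"
  shows "convex_on S (\<lambda>x. \<Sum>k\<in>A. F k x)"
  using assms(1,3) by (induction A) (auto simp: convex_on_const assms(2) intro: convex_on_add)

text \<open>
  The setting of the theorem with \<open>N = n - 1\<close>, so that \<open>c N\<close> is the one coefficient of arbitrary sign.
\<close>
locale inverse_sigma =
  fixes c :: "nat \<Rightarrow> real" and N :: nat and f :: "real ^ 'n::finite \<Rightarrow> real"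
  assumes f_def: "f = inverse_sigma_poly c"
    and dim: "CARD('n) = Suc N" and N_pos: "0 < N"
    and nonneg: "\<And>k. k < N \<Longrightarrow> 0 \<le> c k"
    and some_pos: "\<exists>k < N. 0 < c k"
begin

abbreviation e :: "nat \<Rightarrow> real ^ 'n \<Rightarrow> real" where "e k \<equiv> esub k UNIV"
abbreviation G :: "(real ^ 'n) set" where "G \<equiv> gcone N UNIV"

definition region :: "(real ^ 'n) set" where
  "region = {x \<in> G. 0 < f x}"

lemma f_expand: "f x = e (Suc N) x + c N * e N x - (\<Sum>k<N. c k * e k x)"
proof -
  have "{0..CARD('n) - 2} = {..<N}" using dim N_pos by auto
  then show ?thesis
    unfolding f_def inverse_sigma_poly_def prod_eq_esub esym_eq_esub by (simp add: dim)
qed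

lemma continuous_f: "continuous_on S f"
proof -
  have "f = (\<lambda>x. e (Suc N) x + c N * e N x - (\<Sum>k<N. c k * e k x))"
    by (rule ext) (rule f_expand)
  then show ?thesis by (auto intro!: continuous_intros)
qed

lemma coord_affine_f: "coord_affine f"
proof -
  have "f = (\<lambda>x. e (Suc N) x + c N * e N x - (\<Sum>k<N. c k * e k x))"
    by (rule ext) (rule f_expand)
  then show ?thesis
    by (auto intro!: coord_affine_add coord_affine_diff coord_affine_cmult coord_affine_sum
        coord_affine_esub)
qed

lemma esub_pos_on_G: "\<lbrakk>x \<in> G; k \<le> N\<rbrakk> \<Longrightarrow> 0 < e k x"
  using gcone_antimono[of k N UNIV] gcone_esub_pos by blast

text \<open>
  The quotient of \<open>f\<close> by the polynomial \<open>e N\<close>, up to the constant \<open>c N\<close>; see \<open>f_eq_h\<close>.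
\<close>
definition h :: "real ^ 'n \<Rightarrow> real" where
  "h x = eratio N UNIV x - (\<Sum>k<N. c k * (e k x / e N x))"

lemma f_eq_h: "x \<in> G \<Longrightarrow> f x = (h x + c N) * e N x"
proof -
  assume x: "x \<in> G"
  have "e N x \<noteq> 0" using gcone_esub_pos[OF x] by simp
  then have "(\<Sum>k<N. c k * e k x) = (\<Sum>k<N. c k * (e k x / e N x)) * e N x"
    by (simp add: sum_distrib_right)
  then show ?thesis
    unfolding f_expand h_def esub_Suc_eq_eratio[OF x] by (simp add: algebra_simps)
qed

lemma f_pos_iff: "x \<in> G \<Longrightarrow> 0 < f x \<longleftrightarrow> - c N < h x"
  using gcone_esub_pos[of x N UNIV] by (auto simp: f_eq_h zero_less_mult_iff)

lemma f_eq_0_iff: "x \<in> G \<Longrightarrow> f x = 0 \<longleftrightarrow> h x = - c N"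
  using gcone_esub_pos[of x N UNIV] by (auto simp: f_eq_h)

lemma convex_G: "convex G"
  using concave_on_eratio concave_on_imp_convex by blast

lemma concave_h: "concave_on G h"
proof -
  have "convex_on G (\<lambda>x. \<Sum>k<N. c k * (e k x / e N x))"
    using nonneg
    by (intro convex_on_sum_fun convex_G convex_on_cmul convex_on_esub_quotient) auto
  then show ?thesis
    unfolding h_def[abs_def] by (intro concave_on_diff concave_on_eratio)
qed

lemma convex_region: "convex region"
  unfolding convex_def
proof (intro ballI allI impI)
  fix x y and u v :: real
  assume xy: "x \<in> region" "y \<in> region" and uv: "0 \<le> u" "0 \<le> v" "u + v = 1"
  then have G: "x \<in> G" "y \<in> G" by (auto simp: region_def)
  then have z: "u *\<^sub>R x + v *\<^sub>R y \<in> G" using convex_G uv by (simp add: convex_def)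
  have "- c N < h x" "- c N < h y" using xy G f_pos_iff by (auto simp: region_def)
  then have "- c N < u * h x + v * h y"
    using convex_bound_lt[of "- h x" "c N" "- h y" u v] uv by simp
  also have "\<dots> \<le> h (u *\<^sub>R x + v *\<^sub>R y)"
    using concave_h G uv unfolding concave_on_iff by blast
  finally show "u *\<^sub>R x + v *\<^sub>R y \<in> region" using z f_pos_iff by (simp add: region_def)
qed

lemma open_region: "open region"
proof -
  have "region = G \<inter> {x. 0 < f x}" by (auto simp: region_def)
  moreover have "open {x. 0 < f x}"
    by (intro open_Collect_less continuous_f continuous_on_const)
  ultimately show ?thesis using open_gcone by auto
qed

text \<open>
  On the diagonal, at \<open>t \<ge> 1\<close>, the leading term is \<open>t\<^sup>N\<^sup>+\<^sup>1\<close> and all the others together are at least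
  \<open>- B * t\<^sup>N\<close>.
\<close>
lemma region_nonempty: "region \<noteq> {}"
proof -
  let ?w = "(\<chi> i. 1) :: real ^ 'n"
  define B where "B = \<bar>c N\<bar> * e N ?w + (\<Sum>k<N. c k * e k ?w)"
  define t where "t = 1 + B"
  have w: "0 \<le> e k ?w" for k unfolding esub_def by simp
  have "0 \<le> B" unfolding B_def using w nonneg by (intro add_nonneg_nonneg sum_nonneg) auto
  then have t: "1 \<le> t" by (simp add: t_def)
  have "t *\<^sub>R ?w \<in> G"
    using t N_pos by (intro gcone_if_one_dominated[where M = t and j = undefined]) (auto simp: dim intro!: add_pos_nonneg)
  moreover have "0 < f (t *\<^sub>R ?w)"
  proof -
    have top: "e (Suc N) ?w = 1" unfolding dim[symmetric] prod_eq_esub[symmetric] by simp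
    have "(\<Sum>k<N. c k * (t ^ k * e k ?w)) \<le> (\<Sum>k<N. c k * (t ^ N * e k ?w))"
      using t nonneg w by (intro sum_mono mult_left_mono mult_right_mono power_increasing) auto
    moreover have "- (c N * (t ^ N * e N ?w)) \<le> \<bar>c N\<bar> * (t ^ N * e N ?w)"
      using t w by (subst mult_minus_left[symmetric], intro mult_right_mono) auto
    moreover have "\<bar>c N\<bar> * (t ^ N * e N ?w) + (\<Sum>k<N. c k * (t ^ N * e k ?w)) = t ^ N * B"
      unfolding B_def by (simp add: algebra_simps sum_distrib_left)
    ultimately have "t ^ N * t - t ^ N * B \<le> f (t *\<^sub>R ?w)"
      unfolding f_expand esub_scaleR top by simp
    moreover have "t ^ N * t - t ^ N * B = t ^ N" by (simp add: t_def algebra_simps)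
    moreover have "0 < t ^ N" using t by simp
    ultimately show ?thesis by linarith
  qed
  ultimately show ?thesis by (auto simp: region_def)
qed

text \<open>
  Let \<open>c\<^sub>k > 0\<close> and let \<open>s\<close> be the sum of the coordinates. On the region \<open>c\<^sub>k * e\<^sub>k \<le> e\<^sub>N\<^sub>+\<^sub>1 + c\<^sub>N * e\<^sub>N \<le> (s + \<bar>c\<^sub>N\<bar>) * e\<^sub>N\<close>,
  while \<open>e\<^sub>N\<close> is at most \<open>e\<^sub>k\<close> times a power of \<open>s\<close> times the smallest quotient
  \<open>e\<^sub>N / e\<^sub>N\<^sub>-\<^sub>1\<close>. So this quotient, and with it \<open>e\<^sub>N\<close>, has a positive lower bound in terms of \<open>s\<close>. Written
  without division, the bound passes to the closure and prevents \<open>e\<^sub>N\<close> from vanishing there.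
\<close>
lemma closure_region_subset_G: "closure region \<subseteq> G"
proof
  fix x assume x: "x \<in> closure region"
  obtain k where k: "k < N" "0 < c k" using some_pos by blast
  obtain m where m: "N = Suc m" using N_pos gr0_implies_Suc by blast
  let ?s = "\<lambda>y :: real ^ 'n. \<Sum>i\<in>UNIV. y $ i"
  let ?b = "\<lambda>y. (?s y + \<bar>c N\<bar>) * ?s y ^ (m - k)"
  have bound: "c k ^ N \<le> ?b y ^ N * e N y" if "y \<in> region" for y
  proof -
    have y: "y \<in> G" "0 < f y" using that by (auto simp: region_def)
    have yS: "y \<in> gcone (Suc m) UNIV" using y(1) unfolding m .
    then have ym: "y \<in> gcone m UNIV" using gcone_Suc_subset by blast
    have s: "0 < ?s y" using sum_coord_pos[OF y(1)] N_pos by simp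
    have pos: "0 < e N y" "0 < e k y" "0 < eratio m UNIV y"
      using esub_pos_on_G[OF y(1)] k eratio_pos[OF yS] by auto
    have "c k * e k y \<le> (\<Sum>k<N. c k * e k y)"
      using k nonneg esub_pos_on_G[OF y(1)] by (intro member_le_sum) (auto simp: less_imp_le)
    also have "\<dots> \<le> e (Suc N) y + c N * e N y" using y(2) by (simp add: f_expand)
    also have "\<dots> = (eratio N UNIV y + c N) * e N y"
      unfolding esub_Suc_eq_eratio[OF y(1)] by (simp add: algebra_simps)
    also have "\<dots> \<le> (?s y + \<bar>c N\<bar>) * e N y"
      using eratio_le_sum[OF y(1)] pos by (intro mult_right_mono add_mono) auto
    also have "e N y = eratio m UNIV y * e m y"
      unfolding m by (rule esub_Suc_eq_eratio[OF ym])
    also have "(?s y + \<bar>c N\<bar>) * (eratio m UNIV y * e m y)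
        \<le> (?s y + \<bar>c N\<bar>) * (eratio m UNIV y * (?s y ^ (m - k) * e k y))"
      using esub_le_power_sum[OF ym, of k] k m pos s by (intro mult_left_mono) auto
    finally have "c k * e k y \<le> ?b y * eratio m UNIV y * e k y" by (simp add: algebra_simps)
    then have "c k \<le> ?b y * eratio m UNIV y" using pos(2) by simp
    then have "c k ^ N \<le> ?b y ^ N * eratio m UNIV y ^ N"
      using k(2) by (subst power_mult_distrib[symmetric]) (intro power_mono, auto)
    also have "\<dots> \<le> ?b y ^ N * e N y"
      using eratio_power_le_esub[OF yS] s unfolding m by (intro mult_left_mono) auto
    finally show ?thesis .
  qed
  have "c k ^ N \<le> ?b x ^ N * e N x"
    by (rule le_on_closure[OF bound _ _ x]) (auto intro!: continuous_intros)
  moreover have "0 < c k ^ N" using k by simp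
  ultimately have "e N x \<noteq> 0" by auto
  moreover have "0 \<le> e N x"
    by (rule le_on_closure[OF _ _ _ x])
      (auto intro!: continuous_intros less_imp_le gcone_esub_pos simp: region_def)
  moreover have "x \<in> closure G"
    using x closure_mono[of region G] by (auto simp: region_def)
  ultimately show "x \<in> G" using closure_gcone_esub_pos by force
qed

text \<open>
  The difference \<open>x\<^sub>i * e\<^sub>N - e\<^sub>N\<^sub>+\<^sub>1\<close> equals \<open>x\<^sub>i\<^sup>2\<close> times a partial derivative of \<open>e\<^sub>N\<close>, so it is
  nonnegative, and \<open>f > 0\<close> forces \<open>e\<^sub>N\<^sub>+\<^sub>1 + c\<^sub>N * e\<^sub>N > 0\<close>.
\<close>
lemma region_coord_bound:
  assumes "x \<in> region"
  shows "- c N < x $ i"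
proof -
  have x: "x \<in> G" "0 < f x" using assms by (auto simp: region_def)
  obtain m where m: "N = Suc m" using N_pos gr0_implies_Suc by blast
  have "card (UNIV - {i} :: 'n set) < Suc N" by (simp add: card_Diff_singleton dim)
  then have top: "e (Suc N) x = x $ i * esub N (UNIV - {i}) x"
    by (simp add: esub_Suc_remove[of i UNIV] esub_eq_0)
  have rec: "e N x = x $ i * esub m (UNIV - {i}) x + esub N (UNIV - {i}) x"
    unfolding m by (rule esub_Suc_remove) simp
  have p: "0 < esub m (UNIV - {i}) x"
    using x(1) m gcone_esub_pos by auto
  have "x $ i * e N x = e (Suc N) x + (x $ i)\<^sup>2 * esub m (UNIV - {i}) x"
    unfolding top rec by (simp add: algebra_simps power2_eq_square)
  moreover have "0 \<le> (x $ i)\<^sup>2 * esub m (UNIV - {i}) x" using p by simp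
  moreover have "0 \<le> (\<Sum>k<N. c k * e k x)"
    using nonneg esub_pos_on_G[OF x(1)] by (intro sum_nonneg mult_nonneg_nonneg) (auto simp: less_imp_le)
  ultimately have "0 < (x $ i + c N) * e N x"
    using x(2) unfolding f_expand by (simp add: algebra_simps)
  then show ?thesis using gcone_esub_pos[OF x(1)] by (simp add: zero_less_mult_iff)
qed

lemma is_positive_region_region: "is_positive_region f region"
  unfolding is_positive_region_def
proof
  have "region \<subseteq> {x. 0 < f x}" by (auto simp: region_def)
  then have "openin (top_of_set {x. 0 < f x}) region"
    using open_region by (rule open_subset)
  moreover have "closedin (top_of_set {x. 0 < f x}) region"
  proof -
    have "region = {x. 0 < f x} \<inter> closure region"
      using closure_region_subset_G closure_subset[of region] by (auto simp: region_def)
    then show ?thesis using closedin_closed_Int[OF closed_closure] by metis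
  qed
  ultimately show "region \<in> components {x. 0 < f x}"
    using convex_region region_nonempty
    by (intro clopen_connected_in_components convex_connected)
  show "in_orthant_translate region"
    unfolding in_orthant_translate_iff
    using region_coord_bound by (intro exI[of _ "\<chi> i. - c N"]) simp
qed

text \<open>
  A zero of \<open>f\<close> in \<open>G\<close> is a limit of points of the region: by concavity, \<open>h\<close> exceeds \<open>- c N\<close> on the
  open segment that joins the zero to a point of the region.
\<close>
lemma frontier_region: "frontier region = {x \<in> G. f x = 0}"
proof (intro equalityI subsetI)
  fix x assume "x \<in> frontier region"
  then have cl: "x \<in> closure region" and "x \<notin> region"
    using open_region by (auto simp: frontier_def interior_open)
  then have x: "x \<in> G" using closure_region_subset_G by blast
  have "0 \<le> f x"
    by (rule le_on_closure[OF _ _ continuous_f cl]) (auto simp: region_def)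
  then show "x \<in> {x \<in> G. f x = 0}" using \<open>x \<notin> region\<close> x by (auto simp: region_def)
next
  fix x assume "x \<in> {x \<in> G. f x = 0}"
  then have x: "x \<in> G" "f x = 0" "x \<notin> region" by (auto simp: region_def)
  obtain y where y: "y \<in> region" using region_nonempty by blast
  have yG: "y \<in> G" using y by (simp add: region_def)
  have "open_segment x y \<subseteq> region"
  proof
    fix z assume "z \<in> open_segment x y"
    then obtain u where u: "0 < u" "u < 1" "z = (1 - u) *\<^sub>R x + u *\<^sub>R y"
      by (auto simp: in_segment)
    have "h x = - c N" "- c N < h y"
      using x yG y f_eq_0_iff f_pos_iff by (auto simp: region_def)
    then have "(1 - u) * (- c N) + u * (- c N) < (1 - u) * h x + u * h y"
      using u mult_strict_left_mono[of "- c N" "h y" u] by simp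
    also have "\<dots> \<le> h z"
      using concave_h x(1) yG u unfolding concave_on_iff by simp
    finally have "- c N < h z" by (simp add: algebra_simps)
    moreover have "z \<in> G" using convex_G x(1) yG u by (simp add: convex_def)
    ultimately show "z \<in> region" using f_pos_iff by (simp add: region_def)
  qed
  moreover have "x \<noteq> y" using x y by auto
  then have "x \<in> closure (open_segment x y)" by simp
  ultimately have "x \<in> closure region" using closure_mono by blast
  then show "x \<in> frontier region"
    using x(3) open_region by (simp add: frontier_def interior_open)
qed

lemma is_level_set_frontier: "is_level_set f (frontier region)"
  unfolding is_level_set_def
proof
  have up: "y \<in> region" if "x \<in> region" "\<And>i. x $ i \<le> y $ i" for x y
    using positive_region_upward_closed[OF coord_affine_f is_positive_region_region] that by blast
  have conn: "connected (frontier region)"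
    using open_region convex_region region_nonempty up by (rule connected_frontier_upward_closed)
  have "(\<chi> i. - c N) \<notin> region" using region_coord_bound by fastforce
  then have "frontier region \<noteq> {}" using region_nonempty by (auto simp: frontier_eq_empty)
  moreover have "openin (top_of_set {x. f x = 0}) (frontier region)"
  proof -
    have "frontier region = {x. f x = 0} \<inter> G" unfolding frontier_region by auto
    then show ?thesis using openin_open_Int[OF open_gcone] by simp
  qed
  moreover have "closedin (top_of_set {x. f x = 0}) (frontier region)"
    by (rule closed_subset[OF _ frontier_closed]) (auto simp: frontier_region)
  ultimately show "frontier region \<in> components {x. f x = 0}"
    using conn by (intro clopen_connected_in_components)
  have "- c N \<le> x $ i" if "x \<in> closure region" for x i
    by (rule le_on_closure[OF _ _ _ that])
      (auto intro!: continuous_intros less_imp_le region_coord_bound)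
  \<comment> \<open>On the closure the bound is no longer strict, so the orthant is moved by one.\<close>
  then have "- c N - 1 < x $ i" if "x \<in> frontier region" for x i
    using that[unfolded frontier_def] by (smt (verit) DiffD1)
  then show "in_orthant_translate (frontier region)"
    unfolding in_orthant_translate_iff by (intro exI[of _ "\<chi> i. - c N - 1"]) simp
qed

text \<open>
  A level set contains a point whose coordinates are all large except for the coordinate \<open>j\<close>, which is
  bounded below. Such a point lies in \<open>G\<close>, hence in the frontier of the region.
\<close>
lemma level_set_unique:
  assumes T: "is_level_set f T"
  shows "T = frontier region"
proof -
  have comp: "T \<in> components {x. f x = 0}" "frontier region \<in> components {x. f x = 0}"
    using T is_level_set_frontier by (auto simp: is_level_set_def)
  obtain q where q: "\<And>y j. y \<in> T \<Longrightarrow> q $ j < y $ j"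
    using T unfolding is_level_set_def in_orthant_translate_iff by blast
  fix j :: 'n
  define M where "M = 1 + real CARD('n) * \<bar>q $ j\<bar>"
  obtain y where y: "y \<in> T" "\<And>i. i \<noteq> j \<Longrightarrow> M \<le> y $ i"
    using level_set_far_point[OF coord_affine_f T, of j M] by blast
  have "M / real CARD('n) = 1 / real CARD('n) + \<bar>q $ j\<bar>"
    unfolding M_def by (simp add: field_simps)
  moreover have "0 < 1 / real CARD('n)" by simp
  ultimately have "0 < y $ j + M / real CARD('n)" using q[OF y(1), of j] by linarith
  moreover have "0 < M" unfolding M_def by (simp add: add_pos_nonneg)
  ultimately have "y \<in> G"
    using y(2) dim by (intro gcone_if_one_dominated[where M = M and j = j]) auto
  then have "y \<in> frontier region"
    using y(1) in_components_subset[OF comp(1)] by (auto simp: frontier_region)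
  then show ?thesis using y(1) components_eq[OF comp] by blast
qed

lemma convex_level_set_f: "convex_level_set f"
proof -
  have unique: "C = region" if "is_positive_region f C" for C
    using positive_region_unique[OF coord_affine_f that is_positive_region_region] .
  show ?thesis
    unfolding convex_level_set_def
  proof (intro conjI allI impI)
    show "\<exists>!S. is_level_set f S" using is_level_set_frontier level_set_unique by blast
    show "\<exists>!C. is_positive_region f C" using is_positive_region_region unique by blast
  next
    fix S C assume "is_level_set f S \<and> is_positive_region f C"
    then show "S = frontier C" "convex (closure C)"
      using level_set_unique unique convex_region by (auto intro: convex_closure)
  qed
qed

end

theorem lemma4p1:
  fixes c :: "nat \<Rightarrow> real"
  assumes "CARD('n::finite) \<ge> 2"
    and "\<And>k. k \<in> {0..CARD('n) - 2} \<Longrightarrow> c k \<ge> 0"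
    and "(\<Sum>k = 0..CARD('n) - 2. c k) > 0"
  shows "convex_level_set (inverse_sigma_poly c :: real ^ 'n \<Rightarrow> real)"
proof -
  have "\<exists>k\<in>{0..CARD('n) - 2}. 0 < c k"
  proof (rule ccontr)
    assume "\<not> (\<exists>k\<in>{0..CARD('n) - 2}. 0 < c k)"
    then have "(\<Sum>k = 0..CARD('n) - 2. c k) \<le> 0" by (intro sum_nonpos) force
    then show False using assms(3) by simp
  qed
  moreover have "k < CARD('n) - 1 \<longleftrightarrow> k \<in> {0..CARD('n) - 2}" for k using assms(1) by auto
  ultimately interpret inverse_sigma c "CARD('n) - 1" "inverse_sigma_poly c :: real ^ 'n \<Rightarrow> real"
    using assms by unfold_locales auto
  show ?thesis by (rule convex_level_set_f)
qed

end
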